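(* Let $H$ be a commutative monoid. If $H$ is acyclic and l.f.g.u., then $H$ is FF.
   Context: Let $H$ be a multiplicatively written monoid with identity $1_H$. Units and atoms. $H^\times$ is the group of units of $H$ (elements with a two-sided inverse). An atom of $H$ is an element $a \in H \setminus H^\times$ such that $a \ne xy$ for all $x,y \in H\setminus H^\times$; $\mathscr A(H)$ is the set of atoms. Write $x \simeq_H y$ if $x \in H^\times y H^\times$, and $x \mid_H y$ if $y = uxv$ for some $u,v \in H$. $H$ is acyclic if $x\ne uxv$ for all $u,v,x\in H$ with $u\notin H^\times$ or $v\notin H^\times$. Generation. For $X \subseteq H$, $\mathrm{Sgp}\langle X\rangle_H$ is the subsemigroup generated by $X$, i.e. the set of all products $x_1\cdots x_n$ with $n \ge 1$ and $x_i \in X$ (empty if $X=\emptyset$). $H$ is f.g.u. if there is a finite set $A \subseteq H$ with $H\setminus H^\times \subseteq \mathrm{Sgp}\langle H^\times A H^\times\rangle_H$, where $H^\times A H^\times = \{uav : u,v\in H^\times, a \in A\}$. A submonoid $M$ of $H$ is divisor-closed if $x \mid_H y$ and $y\in M$ imply $x \in M$. For $x\in H$, $\langle\langle x\rangle\rangle_H$ is the smallest divisor-closed submonoid of $H$ containing $x$. $H$ is l.f.g.u. if the monoid $\langle\langle x\rangle\rangle_H$ is f.g.u. for every $x\in H$. Factorizations. $\mathscr F(\mathscr A(H))$ is the free monoid on the set $\mathscr A(H)$, with operation $\ast$ (concatenation) and empty word $\varepsilon$; $\pi_H:\mathscr F(\mathscr A(H))\to H$ is the monoid homomorphism with $\pi_H(a)=a$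 for all $a\in\mathscr A(H)$. For $x\in H$, $\mathcal Z_H(x) := \{\mathfrak a\in\mathscr F(\mathscr A(H)) : \pi_H(\mathfrak a)=x\}$. $H$ is atomic if $\mathcal Z_H(x)\neq\emptyset$ for every $x\in H\setminus H^\times$. $\mathscr C_H$ is the congruence on $\mathscr F(\mathscr A(H))$ with $\mathfrak a \equiv\mathfrak b \bmod \mathscr C_H$ iff either $\mathfrak a=\mathfrak b=\varepsilon$, or $\mathfrak a=a_1\ast\cdots\ast a_n$ and $\mathfrak b=b_1\ast\cdots\ast b_n$ have the same length $n\ge1$, $\pi_H(\mathfrak a)=\pi_H(\mathfrak b)$, and there is a permutation $\sigma$ of $\{1,\dots,n\}$ with $a_i\simeq_H b_{\sigma(i)}$ for all $i$. $\mathsf Z_H(x)$ is the set of $\mathscr C_H$-classes of elements of $\mathcal Z_H(x)$. $H$ is FF if $H$ is atomic and $\mathsf Z_H(x)$ is finite for every $x\in H$. *)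

theory Defs
  imports "HOL-Algebra.Coset" "HOL-Combinatorics.Permutations"
begin

section \<open>Units, divisibility, atoms\<close>

text \<open>
  The library's \<open>divides\<close>, \<open>associated\<close> and \<open>irreducible\<close> (HOL-Algebra.Divisibility) are based
  on one-sided divisibility; the notions below are the two-sided ones, meaningful in an arbitrary
  monoid, and atoms are defined by non-decomposability into non-units.
\<close>

definition mdvd :: "('a, 'b) monoid_scheme \<Rightarrow> 'a \<Rightarrow> 'a \<Rightarrow> bool" where
  "mdvd H x y \<longleftrightarrow> (\<exists>u\<in>carrier H. \<exists>v\<in>carrier H. y = u \<otimes>\<^bsub>H\<^esub> x \<otimes>\<^bsub>H\<^esub> v)"

definition unit_equiv :: "('a, 'b) monoid_scheme \<Rightarrow> 'a \<Rightarrow> 'a \<Rightarrow> bool" where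
  "unit_equiv H x y \<longleftrightarrow> (\<exists>u\<in>Units H. \<exists>v\<in>Units H. x = u \<otimes>\<^bsub>H\<^esub> y \<otimes>\<^bsub>H\<^esub> v)"

definition atoms :: "('a, 'b) monoid_scheme \<Rightarrow> 'a set" where
  "atoms H = {a \<in> carrier H - Units H.
     \<forall>x \<in> carrier H - Units H. \<forall>y \<in> carrier H - Units H. a \<noteq> x \<otimes>\<^bsub>H\<^esub> y}"

definition acyclic_monoid :: "('a, 'b) monoid_scheme \<Rightarrow> bool" where
  "acyclic_monoid H \<longleftrightarrow>
     (\<forall>u\<in>carrier H. \<forall>v\<in>carrier H. \<forall>x\<in>carrier H.
        u \<notin> Units H \<or> v \<notin> Units H \<longrightarrow> x \<noteq> u \<otimes>\<^bsub>H\<^esub> x \<otimes>\<^bsub>H\<^esub> v)"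


section \<open>Generation\<close>

definition mprod :: "('a, 'b) monoid_scheme \<Rightarrow> 'a list \<Rightarrow> 'a" where
  "mprod H xs = foldr (\<otimes>\<^bsub>H\<^esub>) xs \<one>\<^bsub>H\<^esub>"

definition sgp :: "('a, 'b) monoid_scheme \<Rightarrow> 'a set \<Rightarrow> 'a set" where
  "sgp H X = {mprod H xs | xs. xs \<noteq> [] \<and> set xs \<subseteq> X}"

definition fgu :: "('a, 'b) monoid_scheme \<Rightarrow> bool" where
  "fgu H \<longleftrightarrow> (\<exists>A. finite A \<and> A \<subseteq> carrier H \<and>
     carrier H - Units H \<subseteq> sgp H (Units H <#>\<^bsub>H\<^esub> A <#>\<^bsub>H\<^esub> Units H))"

definition divisor_closed :: "('a, 'b) monoid_scheme \<Rightarrow> 'a set \<Rightarrow> bool" where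
  "divisor_closed H M \<longleftrightarrow>
     submonoid M H \<and> (\<forall>x\<in>carrier H. \<forall>y\<in>M. mdvd H x y \<longrightarrow> x \<in> M)"

definition dc_hull :: "('a, 'b) monoid_scheme \<Rightarrow> 'a \<Rightarrow> 'a set" where
  "dc_hull H x = \<Inter>{M. divisor_closed H M \<and> x \<in> M}"

lemma (in monoid) divisor_closed_carrier: "divisor_closed G (carrier G)"
  by (auto simp: divisor_closed_def intro: submonoid.intro)

lemma (in monoid) divisor_closed_dc_hull:
  assumes "x \<in> carrier G"
  shows "divisor_closed G (dc_hull G x)"
proof -
  have "dc_hull G x \<subseteq> carrier G"
    using assms divisor_closed_carrier by (auto simp: dc_hull_def)
  moreover have "submonoid M G" if "divisor_closed G M" for M
    using that by (simp add: divisor_closed_def)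
  ultimately have "submonoid (dc_hull G x) G"
    by (intro submonoid.intro)
      (auto simp: dc_hull_def intro: submonoid.m_closed submonoid.one_closed)
  then show ?thesis
    by (auto simp: divisor_closed_def dc_hull_def)
qed

lemma dc_hull_least:
  assumes "divisor_closed H M" "x \<in> M"
  shows "x \<in> dc_hull H x" "dc_hull H x \<subseteq> M"
  using assms by (auto simp: dc_hull_def)

text \<open>Units in the following are those of the monoid \<open>dc_hull H x\<close> itself.\<close>

definition lfgu :: "('a, 'b) monoid_scheme \<Rightarrow> bool" where
  "lfgu H \<longleftrightarrow> (\<forall>x\<in>carrier H. fgu (H\<lparr>carrier := dc_hull H x\<rparr>))"


section \<open>Factorizations\<close>

text \<open>
  The free monoid on the atoms is \<open>lists (atoms H)\<close> with concatenation, and \<open>mprod H\<close> restricted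
  to it is the factorization homomorphism.
\<close>

definition factorizations :: "('a, 'b) monoid_scheme \<Rightarrow> 'a \<Rightarrow> 'a list set" where
  "factorizations H x = {\<aa> \<in> lists (atoms H). mprod H \<aa> = x}"

definition atomic :: "('a, 'b) monoid_scheme \<Rightarrow> bool" where
  "atomic H \<longleftrightarrow> (\<forall>x \<in> carrier H - Units H. factorizations H x \<noteq> {})"

definition fact_cong :: "('a, 'b) monoid_scheme \<Rightarrow> ('a list \<times> 'a list) set" where
  "fact_cong H = {(\<aa>, \<bb>). \<aa> \<in> lists (atoms H) \<and> \<bb> \<in> lists (atoms H) \<and>
     (\<aa> = [] \<and> \<bb> = [] \<or>
      length \<aa> = length \<bb> \<and> length \<aa> \<ge> 1 \<and> mprod H \<aa> = mprod H \<bb> \<and>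
      (\<exists>\<sigma>. \<sigma> permutes {..<length \<aa>} \<and>
         (\<forall>i<length \<aa>. unit_equiv H (\<aa> ! i) (\<bb> ! (\<sigma> i)))))}"

definition factorization_classes :: "('a, 'b) monoid_scheme \<Rightarrow> 'a \<Rightarrow> 'a list set set" where
  "factorization_classes H x = factorizations H x // fact_cong H"

definition FF :: "('a, 'b) monoid_scheme \<Rightarrow> bool" where
  "FF H \<longleftrightarrow> atomic H \<and> (\<forall>x\<in>carrier H. finite (factorization_classes H x))"

end

theory Submission
  imports Defs "HOL-Algebra.Divisibility" Complex_Main
begin

text \<open>
  Fix \<open>x\<close> and let \<open>M\<close> be its divisor-closed hull, so that all divisors of \<open>x\<close>, in particular all
  atoms occurring in a factorization of \<open>x\<close>, lie in \<open>M\<close>, and \<open>M\<close> has the same units as the whole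
  monoid. By commutativity finite generation up to units means that every non-unit of \<open>M\<close> is a unit
  times a product of elements of a finite set \<open>A\<close> of non-units
  (\<open>lfgu_obtains_generators\<close>). Both halves of the FF property come from playing this finite set
  against acyclicity, which in the commutative case says that \<open>x = xy\<close> forces \<open>y\<close> to be a unit.

  Existence of factorizations: acyclicity makes ``divides with non-unit cofactor'' a strict order, and
  a strict order on the finite set \<open>A\<close> is well-founded. If \<open>a\<close> in \<open>A\<close> is not an atom, then \<open>a = yz\<close>
  with non-units \<open>y\<close> and \<open>z\<close>, and every generator occurring in \<open>y\<close> or \<open>z\<close> lies strictly below \<open>a\<close>.
  Well-founded induction thus factors every generator into atoms (\<open>generator_factorable\<close>), hence
  every non-unit.

  Finiteness: an atom of \<open>M\<close> is a unit multiple of some element of \<open>A\<close>, so there are only finitely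
  many atoms in \<open>M\<close> up to units. Record a factorization by the multiset of the unit classes of its
  atoms; two factorizations of \<open>x\<close> are congruent if and only if these multisets agree
  (\<open>fact_cong_iff\<close>). If one multiset is contained in another, the surplus atoms have a product
  \<open>n\<close> with \<open>x = xvn\<close> for some unit \<open>v\<close>, so \<open>n\<close> is a unit and there is no surplus
  (\<open>factorizations_antichain\<close>). The multisets arising from \<open>x\<close> therefore form an antichain over a
  finite set, and Dickson's lemma (\<open>finite_multiset_antichain\<close>) makes them finite in number.
\<close>

section \<open>Dickson's lemma for finite multisets\<close>

lemma nat_seq_mono_subseq:
  fixes s :: "nat \<Rightarrow> nat"
  shows "\<exists>f :: nat \<Rightarrow> nat. strict_mono f \<and> mono (\<lambda>n. s (f n))"
proof -
  obtain f where f: "strict_mono f" "monoseq (\<lambda>n. s (f n))"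
    using seq_monosub by blast
  show ?thesis
  proof (cases "\<forall>m. \<forall>n\<ge>m. s (f m) \<le> s (f n)")
    case True
    then have "mono (\<lambda>n. s (f n))" by (simp add: mono_def)
    with f(1) show ?thesis by blast
  next
    case False
    then have dec: "\<And>m n. m \<le> n \<Longrightarrow> s (f n) \<le> s (f m)"
      using f(2) by (auto simp: monoseq_def)
    \<comment> \<open>A decreasing sequence of naturals is constant once it has attained its minimum.\<close>
    define k where "k = (LEAST v. \<exists>n. s (f n) = v)"
    have "\<exists>n. s (f n) = k" unfolding k_def by (rule LeastI_ex) auto
    then obtain N where N: "s (f N) = k" ..
    have "k \<le> s (f n)" for n unfolding k_def by (rule Least_le) auto
    then have const: "s (f (n + N)) = k" for n
      using dec[of N "n + N"] N by (simp add: antisym)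
    have "strict_mono (\<lambda>n. f (n + N))"
      using f(1) by (simp add: strict_mono_def)
    with const show ?thesis by (intro exI[of _ "\<lambda>n. f (n + N)"]) (simp add: mono_def)
  qed
qed

text \<open>
  Thinning out once for each element of the finite set keeps the monotonicity that was
  already obtained for the earlier elements.
\<close>
lemma multiset_seq_mono_subseq:
  fixes s :: "nat \<Rightarrow> 'a multiset"
  assumes "finite A"
  shows "\<exists>f :: nat \<Rightarrow> nat. strict_mono f \<and> (\<forall>a\<in>A. mono (\<lambda>n. count (s (f n)) a))"
  using assms
proof (induction A)
  case empty
  have "strict_mono (id :: nat \<Rightarrow> nat)" by (rule strict_mono_id)
  then show ?case by blast
next
  case (insert a A)
  then obtain f :: "nat \<Rightarrow> nat" where f: "strict_mono f" "\<forall>b\<in>A. mono (\<lambda>n. count (s (f n)) b)"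
    by blast
  obtain g :: "nat \<Rightarrow> nat" where g: "strict_mono g" "mono (\<lambda>n. count (s (f (g n))) a)"
    using nat_seq_mono_subseq[of "\<lambda>n. count (s (f n)) a"] by blast
  have "mono (\<lambda>n. count (s (f (g n))) b)" if "b \<in> A" for b
    using f(2) that strict_mono_mono[OF g(1)] by (simp add: mono_def)
  with g(2) strict_mono_compose[OF f(1) g(1)] show ?case
    by (intro exI[of _ "\<lambda>n. f (g n)"]) auto
qed

text \<open>
  Dickson's lemma: an infinite antichain would contain an injective sequence, and two terms of a
  componentwise monotone subsequence of it are comparable.
\<close>
lemma finite_multiset_antichain:
  assumes "finite A"
    and supp: "\<And>m. m \<in> S \<Longrightarrow> set_mset m \<subseteq> A"
    and anti: "\<And>m n. m \<in> S \<Longrightarrow> n \<in> S \<Longrightarrow> m \<subseteq># n \<Longrightarrow> m = n"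
  shows "finite S"
proof (rule ccontr)
  assume "infinite S"
  then obtain s :: "nat \<Rightarrow> 'a multiset" where s: "inj s" "range s \<subseteq> S"
    using infinite_countable_subset by blast
  obtain f :: "nat \<Rightarrow> nat" where f: "strict_mono f" "\<forall>a\<in>A. mono (\<lambda>n. count (s (f n)) a)"
    using multiset_seq_mono_subseq[OF \<open>finite A\<close>] by blast
  have "count (s (f 0)) a \<le> count (s (f 1)) a" for a
  proof (cases "a \<in> A")
    case True
    then show ?thesis using f(2) by (simp add: mono_def)
  next
    case False
    then have "a \<notin># s (f 0)" using supp[of "s (f 0)"] s(2) by blast
    then show ?thesis by (simp add: not_in_iff)
  qed
  then have "s (f 0) \<subseteq># s (f 1)" by (simp add: subseteq_mset_def)
  then have "s (f 0) = s (f 1)" using anti s(2) by blast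
  then have "f 0 = f 1" using s(1) by (simp add: inj_eq)
  then show False using f(1) by (auto simp: strict_mono_eq)
qed


section \<open>Products and associates in a commutative monoid\<close>

context comm_monoid
begin

lemma mprod_Nil [simp]: "mprod G [] = \<one>"
  and mprod_Cons [simp]: "mprod G (x # xs) = x \<otimes> mprod G xs"
  by (simp_all add: mprod_def)

lemma mprod_closed [simp]: "set xs \<subseteq> carrier G \<Longrightarrow> mprod G xs \<in> carrier G"
  unfolding mprod_def by (rule multlist_closed)

lemma mprod_append:
  "set xs \<subseteq> carrier G \<Longrightarrow> set ys \<subseteq> carrier G \<Longrightarrow> mprod G (xs @ ys) = mprod G xs \<otimes> mprod G ys"
  by (induction xs) (auto simp: m_assoc)

lemma mprod_mset_cong:
  "mset xs = mset ys \<Longrightarrow> set xs \<subseteq> carrier G \<Longrightarrow> mprod G xs = mprod G ys"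
  unfolding mprod_def by (rule multlist_perm_cong)

lemma Units_mult_iff:
  assumes "x \<in> carrier G" "y \<in> carrier G"
  shows "x \<otimes> y \<in> Units G \<longleftrightarrow> x \<in> Units G \<and> y \<in> Units G"
  using assms unit_factor[of x y] unit_factor[of y x] by (auto simp: m_comm)

lemma mprod_Units_iff:
  "set xs \<subseteq> carrier G \<Longrightarrow> mprod G xs \<in> Units G \<longleftrightarrow> set xs \<subseteq> Units G"
  by (induction xs) (auto simp: Units_mult_iff)

lemma unit_equiv_iff:
  assumes "b \<in> carrier G"
  shows "unit_equiv G a b \<longleftrightarrow> (\<exists>u\<in>Units G. a = u \<otimes> b)"
proof
  assume "unit_equiv G a b"
  then obtain u v where "u \<in> Units G" "v \<in> Units G" "a = u \<otimes> b \<otimes> v"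
    by (auto simp: unit_equiv_def)
  then have "a = (u \<otimes> v) \<otimes> b" "u \<otimes> v \<in> Units G"
    using assms by (auto simp: m_ac Units_closed)
  then show "\<exists>u\<in>Units G. a = u \<otimes> b" by blast
next
  assume "\<exists>u\<in>Units G. a = u \<otimes> b"
  then obtain u where "u \<in> Units G" "a = u \<otimes> b \<otimes> \<one>"
    using assms by (auto simp: Units_closed)
  then show "unit_equiv G a b" unfolding unit_equiv_def by blast
qed

lemma unit_equiv_refl: "a \<in> carrier G \<Longrightarrow> unit_equiv G a a"
  by (auto simp: unit_equiv_iff intro!: bexI[of _ \<one>])

lemma unit_equiv_sym:
  assumes "unit_equiv G a b" "b \<in> carrier G"
  shows "unit_equiv G b a"
proof -
  obtain u where u: "u \<in> Units G" "a = u \<otimes> b"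
    using assms by (auto simp: unit_equiv_iff)
  then have "b = inv u \<otimes> a" "a \<in> carrier G"
    using assms(2) by (auto simp: Units_closed m_assoc[symmetric])
  with u(1) show ?thesis by (auto simp: unit_equiv_iff)
qed

lemma unit_equiv_trans:
  assumes "unit_equiv G a b" "unit_equiv G b c" "c \<in> carrier G"
  shows "unit_equiv G a c"
proof -
  obtain v where v: "v \<in> Units G" "b = v \<otimes> c"
    using assms by (auto simp: unit_equiv_iff)
  then have "b \<in> carrier G" using assms(3) by auto
  then obtain u where u: "u \<in> Units G" "a = u \<otimes> b"
    using assms(1) by (auto simp: unit_equiv_iff)
  have "a = (u \<otimes> v) \<otimes> c" using u v assms(3) by (simp add: m_assoc Units_closed)
  moreover have "u \<otimes> v \<in> Units G" using u(1) v(1) by simp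
  ultimately show ?thesis using assms(3) unfolding unit_equiv_iff[OF assms(3)] by blast
qed

text \<open>
  A canonical representative of the class of associates of an element. It turns \<open>unit_equiv\<close> into
  an equality, so that factorizations can be compared through multisets instead of permutations.
  The defining predicate depends only on the class, hence so does the choice.
\<close>
definition unit_rep where
  "unit_rep a = (SOME b. b \<in> carrier G \<and> unit_equiv G a b)"

lemma unit_rep:
  assumes "a \<in> carrier G"
  shows unit_rep_closed: "unit_rep a \<in> carrier G"
    and unit_equiv_unit_rep: "unit_equiv G a (unit_rep a)"
proof -
  have "\<exists>b. b \<in> carrier G \<and> unit_equiv G a b"
    using assms unit_equiv_refl by blast
  from someI_ex[OF this]
  show "unit_rep a \<in> carrier G" "unit_equiv G a (unit_rep a)"
    unfolding unit_rep_def by auto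
qed

lemma unit_rep_eq_iff:
  assumes "a \<in> carrier G" "b \<in> carrier G"
  shows "unit_rep a = unit_rep b \<longleftrightarrow> unit_equiv G a b"
proof
  assume "unit_rep a = unit_rep b"
  then show "unit_equiv G a b"
    using assms unit_rep by (metis unit_equiv_sym unit_equiv_trans)
next
  assume "unit_equiv G a b"
  then have "unit_equiv G a c \<longleftrightarrow> unit_equiv G b c" if "c \<in> carrier G" for c
    using assms that by (metis unit_equiv_sym unit_equiv_trans)
  then show "unit_rep a = unit_rep b"
    unfolding unit_rep_def by (metis (lifting))
qed

lemma mprod_map_unit_rep:
  assumes "set xs \<subseteq> carrier G"
  shows "\<exists>u\<in>Units G. mprod G xs = u \<otimes> mprod G (map unit_rep xs)"
  using assms
proof (induction xs)
  case Nil
  show ?case by (auto intro!: bexI[of _ \<one>])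
next
  case (Cons x xs)
  then obtain u where u: "u \<in> Units G" "mprod G xs = u \<otimes> mprod G (map unit_rep xs)"
    by auto
  have x: "x \<in> carrier G" using Cons.prems by simp
  obtain v where v: "v \<in> Units G" "x = v \<otimes> unit_rep x"
    using unit_rep[OF x] by (auto simp: unit_equiv_iff)
  have reps: "unit_rep x \<in> carrier G" "mprod G (map unit_rep xs) \<in> carrier G"
  proof -
    show "unit_rep x \<in> carrier G" using x by (rule unit_rep_closed)
    have "set (map unit_rep xs) \<subseteq> carrier G"
      using Cons.prems unit_rep_closed by (simp add: image_subset_iff subset_eq)
    then show "mprod G (map unit_rep xs) \<in> carrier G" by (rule mprod_closed)
  qed
  have "mprod G (x # xs) = (v \<otimes> unit_rep x) \<otimes> (u \<otimes> mprod G (map unit_rep xs))"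
    using u(2) v(2) by simp
  also have "\<dots> = (v \<otimes> u) \<otimes> mprod G (map unit_rep (x # xs))"
    using u(1) v(1) reps by (simp add: m_ac Units_closed)
  finally show ?case using u(1) v(1) by blast
qed

lemma atomsD:
  "a \<in> atoms G \<Longrightarrow> a \<in> carrier G" "a \<in> atoms G \<Longrightarrow> a \<notin> Units G"
  by (auto simp: atoms_def)

lemma atom_factor:
  assumes "a \<in> atoms G" "a = x \<otimes> y" "x \<in> carrier G" "y \<in> carrier G"
  shows "x \<in> Units G \<or> y \<in> Units G"
  using assms by (auto simp: atoms_def)

lemma unit_mult_atom:
  assumes u: "u \<in> Units G" and a: "a \<in> atoms G"
  shows "u \<otimes> a \<in> atoms G"
proof -
  have carr: "u \<in> carrier G" "a \<in> carrier G" "a \<notin> Units G"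
    using u a by (auto dest: atomsD)
  have "x \<in> Units G \<or> y \<in> Units G"
    if "u \<otimes> a = x \<otimes> y" "x \<in> carrier G" "y \<in> carrier G" for x y
  proof -
    have "inv u \<otimes> (u \<otimes> a) = (inv u \<otimes> x) \<otimes> y"
      using that u by (simp add: m_assoc)
    moreover have "inv u \<otimes> (u \<otimes> a) = a"
      using u carr by (simp add: m_assoc[symmetric])
    ultimately have "inv u \<otimes> x \<in> Units G \<or> y \<in> Units G"
      using atom_factor[OF a, of "inv u \<otimes> x" y] u that by auto
    then show ?thesis
      using u that by (auto simp: Units_mult_iff)
  qed
  then show ?thesis
    using carr by (auto simp: atoms_def Units_mult_iff)
qed

lemma acyclicD:
  assumes "acyclic_monoid G" "x \<in> carrier G" "y \<in> carrier G" "x = x \<otimes> y"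
  shows "y \<in> Units G"
proof (rule ccontr)
  assume "y \<notin> Units G"
  then have "x \<noteq> \<one> \<otimes> x \<otimes> y"
    using assms(1-3) unfolding acyclic_monoid_def by blast
  then show False using assms(2,4) by simp
qed


section \<open>Finite generation of divisor-closed hulls\<close>

text \<open>
  Units lie in every divisor-closed submonoid because they divide the identity.
\<close>
lemma divisor_closedD:
  assumes "divisor_closed G M"
  shows "M \<subseteq> carrier G"
    and "x \<in> carrier G \<Longrightarrow> y \<in> carrier G \<Longrightarrow> x \<otimes> y \<in> M \<Longrightarrow> x \<in> M \<and> y \<in> M"
    and "Units G \<subseteq> M"
proof -
  have M: "submonoid M G" and dvd: "\<And>x y. x \<in> carrier G \<Longrightarrow> y \<in> M \<Longrightarrow> mdvd G x y \<Longrightarrow> x \<in> M"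
    using assms by (auto simp: divisor_closed_def)
  show "M \<subseteq> carrier G" using M by (rule submonoid.subset)
  show div: "x \<in> M \<and> y \<in> M" if "x \<in> carrier G" "y \<in> carrier G" "x \<otimes> y \<in> M" for x y
  proof -
    have "x \<otimes> y = \<one> \<otimes> x \<otimes> y" "x \<otimes> y = x \<otimes> y \<otimes> \<one>" using that by auto
    then have "mdvd G x (x \<otimes> y)" "mdvd G y (x \<otimes> y)"
      using that unfolding mdvd_def by blast+
    then show ?thesis using dvd that by blast
  qed
  show "Units G \<subseteq> M"
  proof
    fix u assume u: "u \<in> Units G"
    then have "u \<otimes> inv u \<in> M" using submonoid.one_closed[OF M] by simp
    then show "u \<in> M" using div[of u "inv u"] u by auto
  qed
qed

lemma Units_divisor_closed:
  assumes "divisor_closed G M"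
  shows "Units (G\<lparr>carrier := M\<rparr>) = Units G"
proof
  show "Units (G\<lparr>carrier := M\<rparr>) \<subseteq> Units G"
    using divisor_closedD(1)[OF assms] by (auto simp: Units_def)
  show "Units G \<subseteq> Units (G\<lparr>carrier := M\<rparr>)"
  proof
    fix u assume u: "u \<in> Units G"
    then have "u \<in> M" "inv u \<in> M"
      using divisor_closedD(3)[OF assms] by auto
    moreover have "inv u \<otimes> u = \<one>" "u \<otimes> inv u = \<one>"
      using u by simp_all
    ultimately show "u \<in> Units (G\<lparr>carrier := M\<rparr>)"
      unfolding Units_def by (simp, blast)
  qed
qed

text \<open>
  Commutativity collects all unit factors, including those elements of \<open>A\<close> that are themselves
  units, in front of the product.
\<close>
lemma mprod_unit_multiples:
  assumes "set zs \<subseteq> Units G <#> A <#> Units G" "A \<subseteq> carrier G"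
  shows "\<exists>u\<in>Units G. \<exists>bs. set bs \<subseteq> A - Units G \<and> mprod G zs = u \<otimes> mprod G bs"
  using assms(1)
proof (induction zs)
  case Nil
  show ?case by (auto intro!: bexI[of _ \<one>] exI[of _ "[]"])
next
  case (Cons z zs)
  then obtain u bs where u: "u \<in> Units G" "set bs \<subseteq> A - Units G" "mprod G zs = u \<otimes> mprod G bs"
    by auto
  have bs: "mprod G bs \<in> carrier G" using u(2) assms(2) by (auto intro!: mprod_closed)
  obtain v a w where z: "v \<in> Units G" "a \<in> A" "w \<in> Units G" "z = v \<otimes> a \<otimes> w"
    using Cons.prems by (auto simp: set_mult_def)
  have a: "a \<in> carrier G" using z(2) assms(2) by blast
  show ?case
  proof (cases "a \<in> Units G")
    case True
    have "mprod G (z # zs) = (v \<otimes> a \<otimes> w \<otimes> u) \<otimes> mprod G bs"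
      using u z a bs by (simp add: m_assoc Units_closed)
    then show ?thesis using True u(1,2) z(1,3) by (meson Units_m_closed)
  next
    case False
    have "mprod G (z # zs) = (v \<otimes> w \<otimes> u) \<otimes> mprod G (a # bs)"
      using u z a bs by (simp add: m_ac Units_closed)
    moreover have "set (a # bs) \<subseteq> A - Units G" using False u(2) z(2) by simp
    ultimately show ?thesis using u(1) z(1,3) by (meson Units_m_closed)
  qed
qed

text \<open>
  \<open>M\<close> is the divisor-closed hull of \<open>x\<close>. Its units are those of the whole monoid, so finite
  generation inside \<open>M\<close> can be expressed with the units of \<open>G\<close>, and the unit generators can be
  dropped from \<open>A\<close>.
\<close>
lemma lfgu_obtains_generators:
  assumes "lfgu G" "x \<in> carrier G"
  obtains M A where "divisor_closed G M" "x \<in> M" "finite A" "A \<subseteq> M - Units G"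
    "\<And>y. y \<in> M - Units G \<Longrightarrow> \<exists>u\<in>Units G. \<exists>bs. set bs \<subseteq> A \<and> y = u \<otimes> mprod G bs"
proof -
  define M where "M = dc_hull G x"
  have M: "divisor_closed G M" "x \<in> M"
    using divisor_closed_dc_hull[OF assms(2)] by (auto simp: M_def dc_hull_def)
  have "fgu (G\<lparr>carrier := M\<rparr>)" using assms by (simp add: lfgu_def M_def)
  moreover have "sgp (G\<lparr>carrier := M\<rparr>) X = sgp G X" for X
    by (simp add: sgp_def mprod_def)
  moreover have "X <#>\<^bsub>G\<lparr>carrier := M\<rparr>\<^esub> Y = X <#> Y" for X Y
    by (simp add: set_mult_def)
  ultimately obtain A where A: "finite A" "A \<subseteq> M"
    and gen: "M - Units G \<subseteq> sgp G (Units G <#> A <#> Units G)"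
    by (auto simp: fgu_def Units_divisor_closed[OF M(1)])
  have carr: "A \<subseteq> carrier G" using A(2) divisor_closedD(1)[OF M(1)] by blast
  have "\<exists>u\<in>Units G. \<exists>bs. set bs \<subseteq> A - Units G \<and> y = u \<otimes> mprod G bs"
    if "y \<in> M - Units G" for y
  proof -
    obtain zs where "set zs \<subseteq> Units G <#> A <#> Units G" "y = mprod G zs"
      using gen \<open>y \<in> M - Units G\<close> by (auto simp: sgp_def)
    then show ?thesis using mprod_unit_multiples[OF _ carr] by blast
  qed
  then show ?thesis using that[of M "A - Units G"] M A by blast
qed


section \<open>Existence of factorizations\<close>

text \<open>
  The unit is absorbed by the first atom, which exists because the element is not a unit.
\<close>
lemma unit_mult_mprod_atoms:
  assumes "u \<in> Units G" "as \<in> lists (atoms G)" "u \<otimes> mprod G as \<notin> Units G"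
  shows "\<exists>cs\<in>lists (atoms G). mprod G cs = u \<otimes> mprod G as"
proof (cases as)
  case Nil
  then show ?thesis using assms by (auto simp: Units_closed)
next
  case (Cons a as')
  have "set as' \<subseteq> carrier G" using assms(2) Cons by (auto dest: atomsD)
  then have "mprod G ((u \<otimes> a) # as') = u \<otimes> mprod G as"
    using assms(1,2) Cons by (auto simp: m_assoc Units_closed atomsD)
  moreover have "(u \<otimes> a) # as' \<in> lists (atoms G)"
    using assms(1,2) Cons by (auto intro: unit_mult_atom)
  ultimately show ?thesis by blast
qed

lemma mprod_of_factorable:
  assumes "\<And>b. b \<in> set bs \<Longrightarrow> \<exists>as\<in>lists (atoms G). mprod G as = b"
  shows "\<exists>as\<in>lists (atoms G). mprod G as = mprod G bs"
  using assms
proof (induction bs)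
  case Nil
  show ?case by (auto intro!: bexI[of _ "[]"])
next
  case (Cons b bs)
  obtain as where as: "as \<in> lists (atoms G)" "mprod G as = b"
    using Cons.prems[of b] by auto
  obtain cs where cs: "cs \<in> lists (atoms G)" "mprod G cs = mprod G bs"
    using Cons.IH Cons.prems by (meson list.set_intros(2))
  have "set as \<subseteq> carrier G" "set cs \<subseteq> carrier G"
    using as(1) cs(1) by (auto dest: atomsD)
  then have "as @ cs \<in> lists (atoms G)" "mprod G (as @ cs) = mprod G (b # bs)"
    using as cs by (auto simp: mprod_append)
  then show ?case by blast
qed

definition strict_dvd :: "'a \<Rightarrow> 'a \<Rightarrow> bool" where
  "strict_dvd a b \<longleftrightarrow> (\<exists>c\<in>carrier G - Units G. b = a \<otimes> c)"

lemma strict_dvd_trans: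
  assumes "strict_dvd a b" "strict_dvd b c" "a \<in> carrier G"
  shows "strict_dvd a c"
proof -
  obtain m n where m: "m \<in> carrier G - Units G" "b = a \<otimes> m"
    and n: "n \<in> carrier G - Units G" "c = b \<otimes> n"
    using assms by (auto simp: strict_dvd_def)
  then have "c = a \<otimes> (m \<otimes> n)" "m \<otimes> n \<in> carrier G - Units G"
    using assms(3) by (auto simp: m_assoc Units_mult_iff)
  then show ?thesis unfolding strict_dvd_def by blast
qed

lemma strict_dvd_irrefl:
  assumes "acyclic_monoid G" "a \<in> carrier G"
  shows "\<not> strict_dvd a a"
  using acyclicD[OF assms] by (auto simp: strict_dvd_def)

lemma mprod_factor_strict_dvd:
  assumes "set bs \<subseteq> carrier G" "b \<in> set bs" "u \<in> Units G" "z \<in> carrier G - Units G"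
    and a: "a = u \<otimes> mprod G bs \<otimes> z"
  shows "strict_dvd b a"
proof -
  obtain cs ds where bs: "bs = cs @ b # ds" using assms(2) by (meson split_list)
  have carr: "set cs \<subseteq> carrier G" "set ds \<subseteq> carrier G" "b \<in> carrier G" "u \<in> carrier G"
    using assms(1,3) bs by auto
  define e where "e = u \<otimes> mprod G cs \<otimes> mprod G ds \<otimes> z"
  have "a = b \<otimes> e"
    using a bs carr assms(4) by (simp add: e_def mprod_append m_ac)
  moreover have "e \<in> carrier G - Units G"
    using carr assms(3,4) by (auto simp: e_def Units_mult_iff)
  ultimately show ?thesis unfolding strict_dvd_def by blast
qed

text \<open>
  Well-founded induction along strict divisibility on the finite set \<open>A\<close>. A reducible generator \<open>a\<close>
  splits into two non-units of \<open>M\<close>. A generator \<open>b\<close> occurring in one of them divides \<open>a\<close> with a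
  cofactor that contains the other one, and is therefore strictly smaller.
\<close>
lemma generator_factorable:
  assumes acyc: "acyclic_monoid G" and M: "divisor_closed G M"
    and A: "finite A" "A \<subseteq> M - Units G"
    and gen: "\<And>y. y \<in> M - Units G \<Longrightarrow> \<exists>u\<in>Units G. \<exists>bs. set bs \<subseteq> A \<and> y = u \<otimes> mprod G bs"
    and "a \<in> A"
  shows "\<exists>as\<in>lists (atoms G). mprod G as = a"
proof -
  have carr: "A \<subseteq> carrier G" using A(2) divisor_closedD(1)[OF M] by blast
  define R where "R = {(b, a). b \<in> A \<and> a \<in> A \<and> strict_dvd b a}"
  have "trans R"
  proof (rule transI)
    fix b c d assume "(b, c) \<in> R" "(c, d) \<in> R"
    then show "(b, d) \<in> R" using strict_dvd_trans[of b c d] carr by (auto simp: R_def)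
  qed
  moreover have "irrefl R" using strict_dvd_irrefl[OF acyc] carr by (auto simp: R_def irrefl_def)
  ultimately have "acyclic R" by (simp add: acyclic_irrefl)
  moreover have "finite R"
    using A(1) by (auto simp: R_def intro: finite_subset[of _ "A \<times> A"])
  ultimately have "wf R" by (simp add: finite_acyclic_wf)
  then show ?thesis using \<open>a \<in> A\<close>
  proof (induction a)
    case (less a)
    have a: "a \<in> M" "a \<in> carrier G" "a \<notin> Units G" using less.prems A(2) carr by auto
    show ?case
    proof (cases "a \<in> atoms G")
      case True
      then show ?thesis using a by (auto intro!: bexI[of _ "[a]"])
    next
      case False
      then obtain y z where yz: "y \<in> carrier G - Units G" "z \<in> carrier G - Units G" "a = y \<otimes> z"
        using a by (auto simp: atoms_def)
      \<comment> \<open>Stated for arbitrary \<open>y\<close> and \<open>z\<close>, so that it also applies with the two factors swapped.\<close>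
      have factorable: "\<exists>as\<in>lists (atoms G). mprod G as = y"
        if "y \<in> carrier G - Units G" "z \<in> carrier G - Units G" "a = y \<otimes> z" for y z
      proof -
        have "y \<in> M" using divisor_closedD(2)[OF M, of y z] that a(1) by simp
        then obtain u bs where u: "u \<in> Units G" "set bs \<subseteq> A" "y = u \<otimes> mprod G bs"
          using gen[of y] \<open>y \<in> carrier G - Units G\<close> by auto
        have "\<exists>as\<in>lists (atoms G). mprod G as = b" if "b \<in> set bs" for b
        proof -
          have "strict_dvd b a"
            using mprod_factor_strict_dvd[of bs b u z a] u carr that \<open>a = y \<otimes> z\<close>
              \<open>z \<in> carrier G - Units G\<close> by auto
          then show ?thesis using less.IH[of b] less.prems u(2) that by (auto simp: R_def)
        qed
        then obtain as where "as \<in> lists (atoms G)" "mprod G as = mprod G bs"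
          using mprod_of_factorable by blast
        then show ?thesis using unit_mult_mprod_atoms[of u as] u that(1) by auto
      qed
      have "\<exists>as\<in>lists (atoms G). mprod G as = b" if "b \<in> set [y, z]" for b
        using that factorable[of y z] factorable[of z y] yz by (auto simp: m_comm)
      then show ?thesis using mprod_of_factorable[of "[y, z]"] yz by simp
    qed
  qed
qed

lemma acyclic_lfgu_atomic:
  assumes "acyclic_monoid G" "lfgu G"
  shows "atomic G"
  unfolding atomic_def
proof
  fix x assume x: "x \<in> carrier G - Units G"
  then obtain M A where M: "divisor_closed G M" "x \<in> M" and A: "finite A" "A \<subseteq> M - Units G"
    and gen: "\<And>y. y \<in> M - Units G \<Longrightarrow> \<exists>u\<in>Units G. \<exists>bs. set bs \<subseteq> A \<and> y = u \<otimes> mprod G bs"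
    using lfgu_obtains_generators[OF assms(2), of x] by auto
  obtain u bs where u: "u \<in> Units G" "set bs \<subseteq> A" "x = u \<otimes> mprod G bs"
    using gen[of x] M(2) x by auto
  obtain as where "as \<in> lists (atoms G)" "mprod G as = mprod G bs"
    using mprod_of_factorable[of bs] generator_factorable[OF assms(1) M(1) A gen] u(2) by blast
  then show "factorizations G x \<noteq> {}"
    using unit_mult_mprod_atoms[of u as] u x by (auto simp: factorizations_def)
qed


section \<open>Finiteness of the set of factorization classes\<close>

text \<open>
  A permutation matching the atoms up to units is the same as equality of the multisets of
  representatives. In this form the congruence is visibly an equivalence relation with
  classes indexed by multisets.
\<close>
lemma fact_cong_iff:
  assumes "as \<in> lists (atoms G)" "bs \<in> lists (atoms G)"
  shows "(as, bs) \<in> fact_cong G \<longleftrightarrow>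
    mprod G as = mprod G bs \<and> mset (map unit_rep as) = mset (map unit_rep bs)"
proof -
  have carr: "\<And>i. i < length as \<Longrightarrow> as ! i \<in> carrier G" "\<And>i. i < length bs \<Longrightarrow> bs ! i \<in> carrier G"
    using assms by (meson atomsD(1) in_lists_conv_set nth_mem)+
  show ?thesis
  proof
    assume "(as, bs) \<in> fact_cong G"
    then have "as = [] \<and> bs = [] \<or> length as = length bs \<and> mprod G as = mprod G bs \<and>
        (\<exists>p. p permutes {..<length as} \<and> (\<forall>i<length as. unit_equiv G (as ! i) (bs ! p i)))"
      by (simp add: fact_cong_def) blast
    then consider "as = []" "bs = []"
      | p where "length as = length bs" "mprod G as = mprod G bs" "p permutes {..<length as}"
          "\<forall>i<length as. unit_equiv G (as ! i) (bs ! p i)"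
      by blast
    then show "mprod G as = mprod G bs \<and> mset (map unit_rep as) = mset (map unit_rep bs)"
    proof cases
      case 2
      have p: "p permutes {..<length (map unit_rep bs)}"
        using 2(1,3) by simp
      have "map unit_rep as = permute_list p (map unit_rep bs)"
      proof (rule nth_equalityI)
        fix i assume "i < length (map unit_rep as)"
        then have i: "i < length as" "i < length bs" "p i < length bs"
          using 2(1) permutes_in_image[OF 2(3), of i] by simp_all
        then have "unit_rep (as ! i) = unit_rep (bs ! p i)"
          using 2(4) carr by (simp add: unit_rep_eq_iff)
        then show "map unit_rep as ! i = permute_list p (map unit_rep bs) ! i"
          using i p by (simp add: permute_list_nth)
      qed (simp add: 2(1))
      then have "mset (map unit_rep as) = mset (map unit_rep bs)"
        using p by (simp only: mset_permute_list length_map)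
      with 2(2) show ?thesis by (rule conjI)
    qed simp
  next
    assume eq: "mprod G as = mprod G bs \<and> mset (map unit_rep as) = mset (map unit_rep bs)"
    obtain p where p: "p permutes {..<length bs}" "permute_list p (map unit_rep bs) = map unit_rep as"
      using mset_eq_permutation[of "map unit_rep as" "map unit_rep bs"] eq by auto
    have len: "length as = length bs"
      using arg_cong[OF conjunct2[OF eq], of size] by simp
    have equiv: "unit_equiv G (as ! i) (bs ! p i)" if "i < length as" for i
    proof -
      have i: "i < length bs" "p i < length bs"
        using that len permutes_in_image[OF p(1), of i] by auto
      have "unit_rep (as ! i) = map unit_rep as ! i" using that by simp
      also have "\<dots> = unit_rep (bs ! p i)"
        using i p by (simp add: p(2)[symmetric] permute_list_nth)
      finally show ?thesis using unit_rep_eq_iff i that carr by simp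
    qed
    show "(as, bs) \<in> fact_cong G"
    proof (cases "as = []")
      case True
      then show ?thesis using len assms by (simp add: fact_cong_def)
    next
      case False
      have "p permutes {..<length as}" using p(1) len by simp
      then have "\<exists>\<sigma>. \<sigma> permutes {..<length as} \<and>
          (\<forall>i<length as. unit_equiv G (as ! i) (bs ! \<sigma> i))"
        using equiv by blast
      moreover have "length as \<ge> 1" using False by (cases as) auto
      ultimately show ?thesis
        unfolding fact_cong_def mem_Collect_eq case_prod_conv
        using assms conjunct1[OF eq] len by blast
    qed
  qed
qed

text \<open>
  Let \<open>ns\<close> list the surplus of the larger multiset. Replacing all atoms by their representatives
  changes the product only by a unit, so \<open>x\<close> equals \<open>x\<close> times a unit times the product of \<open>ns\<close>.
  Acyclicity makes this product a unit, whereas every member of \<open>ns\<close> is associated to an atom and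
  so is not a unit. Hence \<open>ns\<close> is empty.
\<close>
lemma factorizations_antichain:
  assumes acyc: "acyclic_monoid G" and x: "x \<in> carrier G"
    and as: "as \<in> factorizations G x" and bs: "bs \<in> factorizations G x"
    and sub: "mset (map unit_rep as) \<subseteq># mset (map unit_rep bs)"
  shows "mset (map unit_rep as) = mset (map unit_rep bs)"
proof -
  have carr: "set as \<subseteq> carrier G" "set bs \<subseteq> carrier G" "bs \<in> lists (atoms G)"
    and prod: "mprod G as = x" "mprod G bs = x"
    using as bs by (auto simp: factorizations_def dest: atomsD)
  have rcarr: "set (map unit_rep as) \<subseteq> carrier G" "set (map unit_rep bs) \<subseteq> carrier G"
    using carr unit_rep_closed by auto
  obtain N where "mset (map unit_rep bs) = mset (map unit_rep as) + N"
    using sub by (auto simp: mset_subset_eq_exists_conv)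
  moreover obtain ns where ns: "mset ns = N" using ex_mset by blast
  ultimately have split: "mset (map unit_rep bs) = mset (map unit_rep as @ ns)" by simp
  then have ns_sub: "set ns \<subseteq> set (map unit_rep bs)"
    unfolding set_mset_mset[symmetric] split by simp
  obtain u where u: "u \<in> Units G" "x = u \<otimes> mprod G (map unit_rep as)"
    using mprod_map_unit_rep[OF carr(1)] prod by auto
  obtain v where v: "v \<in> Units G" "x = v \<otimes> mprod G (map unit_rep bs)"
    using mprod_map_unit_rep[OF carr(2)] prod by auto
  have closed: "mprod G (map unit_rep as) \<in> carrier G" "mprod G ns \<in> carrier G"
    using rcarr ns_sub by (meson mprod_closed order_trans)+
  have "set ns \<subseteq> carrier G" using rcarr(2) ns_sub by (rule order_trans[rotated])
  then have "mprod G (map unit_rep bs) = mprod G (map unit_rep as) \<otimes> mprod G ns"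
    using mprod_mset_cong[OF split rcarr(2)] mprod_append[OF rcarr(1)] by simp
  with v(2) have "x = v \<otimes> (mprod G (map unit_rep as) \<otimes> mprod G ns)"
    by simp
  also have "mprod G (map unit_rep as) = inv u \<otimes> x"
    unfolding u(2) using u(1) closed(1) by (simp add: m_assoc[symmetric] Units_closed)
  also have "v \<otimes> (inv u \<otimes> x \<otimes> mprod G ns) = x \<otimes> (v \<otimes> inv u \<otimes> mprod G ns)"
    using u(1) v(1) x closed by (simp add: m_ac Units_closed)
  finally have "v \<otimes> inv u \<otimes> mprod G ns \<in> Units G"
    using acyclicD[OF acyc x] u(1) v(1) closed by (simp add: Units_closed)
  then have "mprod G ns \<in> Units G"
    using u(1) v(1) closed by (simp add: Units_mult_iff Units_closed)
  then have ns_Units: "set ns \<subseteq> Units G"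
    using mprod_Units_iff[OF \<open>set ns \<subseteq> carrier G\<close>] by simp
  have "unit_rep b \<notin> Units G" if "b \<in> set bs" for b
  proof -
    have "b \<in> carrier G" "b \<notin> Units G" using that carr(3) by (auto dest: atomsD)
    then show ?thesis
      using unit_rep[of b] by (metis Units_m_closed unit_equiv_iff)
  qed
  then have "ns = []" using ns_Units ns_sub by (cases ns) auto
  then show ?thesis using split by simp
qed

text \<open>
  Since \<open>a\<close> is irreducible and \<open>b\<close>, the first of the \<open>bs\<close>, is not a unit, everything else is a unit.
\<close>
lemma atom_equiv_generator:
  assumes "a \<in> atoms G" "A \<subseteq> carrier G - Units G" "u \<in> Units G" "set bs \<subseteq> A"
    and a: "a = u \<otimes> mprod G bs"
  shows "\<exists>b\<in>A. unit_equiv G a b"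
proof (cases bs)
  case Nil
  then show ?thesis using assms atomsD(2)[OF assms(1)] by (simp add: Units_closed)
next
  case (Cons b cs)
  have b: "b \<in> A" "b \<in> carrier G" "b \<notin> Units G" "mprod G cs \<in> carrier G"
    using Cons assms(2,4) by (auto intro!: mprod_closed)
  have eq: "a = (u \<otimes> mprod G cs) \<otimes> b"
    using a Cons b assms(3) by (simp add: m_ac Units_closed)
  then have "u \<otimes> mprod G cs \<in> Units G"
    using atom_factor[OF assms(1) eq] b assms(3) by (auto simp: Units_closed)
  then have "unit_equiv G a b"
    unfolding unit_equiv_iff[OF b(2)] using eq by blast
  with b(1) show ?thesis by blast
qed

text \<open>
  The hull of \<open>x\<close> contains every atom that occurs in a factorization of \<open>x\<close>, so all representatives
  come from the finite image of the generators. Dickson's lemma then bounds the multisets, and each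
  multiset determines at most one class.
\<close>
lemma finite_factorization_classes:
  assumes acyc: "acyclic_monoid G" and "lfgu G" and x: "x \<in> carrier G"
  shows "finite (factorization_classes G x)"
proof -
  obtain M A where M: "divisor_closed G M" "x \<in> M" and A: "finite A" "A \<subseteq> M - Units G"
    and gen: "\<And>y. y \<in> M - Units G \<Longrightarrow> \<exists>u\<in>Units G. \<exists>bs. set bs \<subseteq> A \<and> y = u \<otimes> mprod G bs"
    using lfgu_obtains_generators[OF \<open>lfgu G\<close> x] by auto
  have carr: "A \<subseteq> carrier G - Units G" using A(2) divisor_closedD(1)[OF M(1)] by blast
  let ?type = "\<lambda>as. mset (map unit_rep as)"
  have supp: "unit_rep a \<in> unit_rep ` A" if as: "as \<in> factorizations G x" and "a \<in> set as" for a as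
  proof -
    have atom: "a \<in> atoms G" and asc: "set as \<subseteq> carrier G" and prod: "mprod G as = x"
      using that by (auto simp: factorizations_def dest: atomsD)
    obtain bs cs where "as = bs @ a # cs" using \<open>a \<in> set as\<close> by (meson split_list)
    then have "x = a \<otimes> (mprod G bs \<otimes> mprod G cs)" "mprod G bs \<otimes> mprod G cs \<in> carrier G"
      using asc prod by (auto simp: mprod_append m_ac)
    then have "a \<in> M - Units G"
      using divisor_closedD(2)[OF M(1), of a "mprod G bs \<otimes> mprod G cs"] M(2) atomsD[OF atom] by auto
    then obtain b where "b \<in> A" "unit_equiv G a b"
      using gen[of a] atom_equiv_generator[OF atom carr] by blast
    then show ?thesis using unit_rep_eq_iff[of a b] atomsD[OF atom] carr by blast
  qed
  have fin: "finite (?type ` factorizations G x)"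
  proof (rule finite_multiset_antichain)
    show "finite (unit_rep ` A)" using A(1) by simp
    show "set_mset m \<subseteq> unit_rep ` A" if "m \<in> ?type ` factorizations G x" for m
      using that supp by auto
    show "m = n" if "m \<in> ?type ` factorizations G x" "n \<in> ?type ` factorizations G x" "m \<subseteq># n" for m n
      using that factorizations_antichain[OF acyc x] by blast
  qed
  have cls: "fact_cong G `` {as} = {bs \<in> factorizations G x. ?type bs = ?type as}"
    if "as \<in> factorizations G x" for as
  proof -
    have as: "as \<in> lists (atoms G)" "mprod G as = x"
      using that by (auto simp: factorizations_def)
    have "bs \<in> fact_cong G `` {as} \<longleftrightarrow> bs \<in> factorizations G x \<and> ?type bs = ?type as" for bs
    proof (cases "bs \<in> lists (atoms G)")
      case True
      then show ?thesis
        using fact_cong_iff[OF as(1) True] as(2) unfolding factorizations_def by auto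
    next
      case False
      then show ?thesis by (auto simp: fact_cong_def factorizations_def)
    qed
    then show ?thesis by blast
  qed
  have "factorization_classes G x
      \<subseteq> (\<lambda>m. {bs \<in> factorizations G x. ?type bs = m}) ` ?type ` factorizations G x"
    unfolding factorization_classes_def
  proof (rule subsetI, erule quotientE)
    fix C as assume "as \<in> factorizations G x" "C = fact_cong G `` {as}"
    then show "C \<in> (\<lambda>m. {bs \<in> factorizations G x. ?type bs = m}) ` ?type ` factorizations G x"
      using cls by auto
  qed
  then show ?thesis using fin finite_subset by blast
qed

end

theorem corollary4p13:
  fixes H :: "('a, 'b) monoid_scheme"
  assumes "comm_monoid H"
    and "acyclic_monoid H"
    and "lfgu H"
  shows "FF H"
proof -
  interpret comm_monoid H by fact
  show ?thesis
    unfolding FF_def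
    using acyclic_lfgu_atomic finite_factorization_classes assms(2,3) by blast
qed

end
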